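(* Let $\varphi$ be a bounded analytic function on the open unit disc $\mathbb{U}$ that is not univalent. Then there exist a bounded analytic function $\psi$ on $\mathbb{U}$ and a nonzero bounded linear operator $X$ on $H^2$ such that $XT_\varphi=T_\psi X$ and $X$ is not a weighted composition operator.
   Context: $\mathbb{U}$ is the open unit disc in $\mathbb{C}$ and $H^2$ is the Hardy space of $\mathbb{U}$. For a bounded analytic function $\varphi$ on $\mathbb{U}$, $T_\varphi:H^2\to H^2$ is the analytic Toeplitz operator $T_\varphi h=\varphi h$. Univalent means injective on $\mathbb{U}$. A weighted composition operator on $H^2$ is an operator $C_{\omega,h}$ of the form $C_{\omega,h}f=h\cdot(f\circ\omega)$ for $f\in H^2$, where $\omega:\mathbb{U}\to\mathbb{U}$ is holomorphic and $h\in H^2$ is such that $h\cdot(f\circ\omega)\in H^2$ for every $f\in H^2$. *)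

theory Defs
  imports "HOL-Complex_Analysis.Complex_Analysis"
begin

abbreviation unit_disc :: "complex set" where
  "unit_disc \<equiv> ball 0 1"

definition bounded_analytic :: "(complex \<Rightarrow> complex) \<Rightarrow> bool" where
  "bounded_analytic \<phi> \<longleftrightarrow> \<phi> holomorphic_on unit_disc \<and> bounded (\<phi> ` unit_disc)"

definition square_mean :: "(complex \<Rightarrow> complex) \<Rightarrow> real \<Rightarrow> real" where
  "square_mean f r =
     (1 / (2 * pi)) * integral {0..2 * pi} (\<lambda>t. (norm (f (complex_of_real r * cis t)))\<^sup>2)"

text \<open>
  HOL functions are total, so a function on the disc is represented by its extension by zero
  to the whole plane. Equality of elements of \<open>hardy2\<close> is then equality on the disc, and
  the set is closed under the pointwise operations.
\<close>

definition hardy2 :: "(complex \<Rightarrow> complex) set" where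
  "hardy2 = {f. f holomorphic_on unit_disc \<and> (\<forall>z. z \<notin> unit_disc \<longrightarrow> f z = 0) \<and>
                bdd_above (square_mean f ` {0..<1})}"

definition hardy2_norm :: "(complex \<Rightarrow> complex) \<Rightarrow> real" where
  "hardy2_norm f = sqrt (SUP r\<in>{0..<1}. square_mean f r)"

text \<open>
  An operator on \<open>hardy2\<close> is a map on all functions of which only the restriction to
  \<open>hardy2\<close> matters.
\<close>

definition bounded_operator_hardy2 ::
    "((complex \<Rightarrow> complex) \<Rightarrow> (complex \<Rightarrow> complex)) \<Rightarrow> bool" where
  "bounded_operator_hardy2 X \<longleftrightarrow>
     (\<forall>f\<in>hardy2. X f \<in> hardy2) \<and>
     (\<forall>f\<in>hardy2. \<forall>g\<in>hardy2. X (\<lambda>z. f z + g z) = (\<lambda>z. X f z + X g z)) \<and>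
     (\<forall>c. \<forall>f\<in>hardy2. X (\<lambda>z. c * f z) = (\<lambda>z. c * X f z)) \<and>
     (\<exists>K. \<forall>f\<in>hardy2. hardy2_norm (X f) \<le> K * hardy2_norm f)"

text \<open>
  In the next two definitions the zero extension is preserved: \<open>f\<close>, respectively the
  weight \<open>h\<close>, vanishes off the disc.
\<close>

definition toeplitz ::
    "(complex \<Rightarrow> complex) \<Rightarrow> (complex \<Rightarrow> complex) \<Rightarrow> (complex \<Rightarrow> complex)" where
  "toeplitz \<phi> f = (\<lambda>z. \<phi> z * f z)"

definition weighted_comp ::
    "(complex \<Rightarrow> complex) \<Rightarrow> (complex \<Rightarrow> complex) \<Rightarrow> (complex \<Rightarrow> complex) \<Rightarrow> (complex \<Rightarrow> complex)" where
  "weighted_comp \<omega> h f = (\<lambda>z. h z * f (\<omega> z))"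

definition is_weighted_composition_operator ::
    "((complex \<Rightarrow> complex) \<Rightarrow> (complex \<Rightarrow> complex)) \<Rightarrow> bool" where
  "is_weighted_composition_operator X \<longleftrightarrow>
     (\<exists>\<omega> h. \<omega> holomorphic_on unit_disc \<and> \<omega> ` unit_disc \<subseteq> unit_disc \<and> h \<in> hardy2 \<and>
            (\<forall>f\<in>hardy2. weighted_comp \<omega> h f \<in> hardy2) \<and>
            (\<forall>f\<in>hardy2. X f = weighted_comp \<omega> h f))"

end

theory Submission imports Defs begin

text \<open>
  The multiplier \<open>\<psi>\<close> may be taken constant. Choose \<open>a \<noteq> b\<close> in the disc with
  \<open>\<phi> a = \<phi> b = c\<close>. Evaluation at \<open>a\<close> and evaluation at \<open>b\<close> are
  functionals on \<open>H\<^sup>2\<close> that both turn multiplication by \<open>\<phi>\<close> into multiplication by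
  \<open>c\<close>, hence so does their sum. With values viewed as constant functions, the sum is an operator
  \<open>X\<close> of rank one with \<open>X T\<^sub>\<phi> = c X\<close>; it is bounded because point evaluations are
  (\<open>norm_le_hardy2_norm\<close>). Were \<open>X\<close> a weighted composition operator with symbol
  \<open>\<omega>\<close> and weight \<open>h\<close>, then at a single point of the disc the functional
  \<open>f \<mapsto> f a + f b\<close> would be a multiple of evaluation at one point \<open>w\<close>, and
  testing this on \<open>1\<close>, \<open>z\<close>, \<open>z\<^sup>2\<close> forces \<open>(a - b)\<^sup>2 = 0\<close>
  (\<open>sum_of_evaluations_not_multiple_of_evaluation\<close>).
\<close>

lemma square_mean_integrable:
  assumes "f holomorphic_on unit_disc" "0 \<le> r" "r < 1"
  shows "(\<lambda>t. (norm (f (complex_of_real r * cis t)))\<^sup>2) integrable_on {0..2 * pi}"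
proof (intro integrable_continuous_interval continuous_intros)
  have "continuous_on unit_disc f"
    using assms(1) by (rule holomorphic_on_imp_continuous_on)
  moreover have "continuous_on {0..2 * pi} (\<lambda>t. complex_of_real r * cis t)"
    by (intro continuous_intros)
  ultimately show "continuous_on {0..2 * pi} (\<lambda>t. f (complex_of_real r * cis t))"
    by (rule continuous_on_compose2) (use assms in \<open>auto simp: norm_mult\<close>)
qed

lemma square_mean_le:
  assumes "f holomorphic_on unit_disc" "\<And>z. z \<in> unit_disc \<Longrightarrow> norm (f z) \<le> B"
    and "0 \<le> r" "r < 1"
  shows "square_mean f r \<le> B\<^sup>2"
proof -
  have "integral {0..2 * pi} (\<lambda>t. (norm (f (complex_of_real r * cis t)))\<^sup>2)
      \<le> integral {0..2 * pi} (\<lambda>t. B\<^sup>2)"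
  proof (rule integral_le)
    show "(\<lambda>t. (norm (f (complex_of_real r * cis t)))\<^sup>2) integrable_on {0..2 * pi}"
      using assms by (intro square_mean_integrable) auto
  next
    fix t :: real
    have "complex_of_real r * cis t \<in> unit_disc"
      using assms by (simp add: norm_mult)
    then show "(norm (f (complex_of_real r * cis t)))\<^sup>2 \<le> B\<^sup>2"
      using assms(2) by (intro power_mono) auto
  qed auto
  then show ?thesis
    by (simp add: square_mean_def field_simps)
qed

lemma zero_extension_in_hardy2:
  assumes hol: "f holomorphic_on unit_disc" and "\<And>z. z \<in> unit_disc \<Longrightarrow> norm (f z) \<le> B"
  shows "(\<lambda>z. if z \<in> unit_disc then f z else 0) \<in> hardy2"
proof -
  let ?g = "\<lambda>z. if z \<in> unit_disc then f z else 0"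
  have g: "?g holomorphic_on unit_disc"
    using hol by (rule holomorphic_transform) auto
  have "bdd_above (square_mean ?g ` {0..<1})"
    by (rule bdd_aboveI2[of _ _ "B\<^sup>2"], rule square_mean_le[OF g]) (use assms in auto)
  with g show ?thesis
    by (simp add: hardy2_def)
qed

lemma hardy2_norm_constant:
  "hardy2_norm (\<lambda>z. if z \<in> unit_disc then w else 0) = norm w"
proof -
  have "square_mean (\<lambda>z. if z \<in> unit_disc then w else 0) r = (norm w)\<^sup>2"
    if "r \<in> {0..<1}" for r
    using that by (simp add: square_mean_def norm_mult)
  then have "(SUP r\<in>{0..<1}. square_mean (\<lambda>z. if z \<in> unit_disc then w else 0) r)
      = (SUP r\<in>{0..<1::real}. (norm w)\<^sup>2)"
    by (intro SUP_cong) auto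
  then show ?thesis
    by (simp add: hardy2_norm_def)
qed

text \<open>
  Cauchy's formula is applied to \<open>f\<^sup>2\<close> rather than to \<open>f\<close>: the square mean then
  appears directly in the estimate of the integral.
\<close>

lemma norm_squared_le_square_mean:
  assumes hol: "f holomorphic_on unit_disc" and "norm a < r" "r < 1"
  shows "(norm (f a))\<^sup>2 \<le> r / (r - norm a) * square_mean f r"
proof -
  have r: "0 < r"
    using assms(2) norm_ge_zero[of a] by linarith
  let ?z = "\<lambda>t. complex_of_real r * cis t"
  have "(\<lambda>z. (f z)\<^sup>2) holomorphic_on cball 0 r"
    by (intro holomorphic_intros holomorphic_on_subset[OF hol]) (use assms in auto)
  then have "((\<lambda>u. (f u)\<^sup>2 / (u - a)) has_contour_integral (2 * of_real pi * \<i> * (f a)\<^sup>2))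
      (part_circlepath 0 r 0 (2 * pi))"
    using Cauchy_integral_circlepath_simple[of "\<lambda>z. (f z)\<^sup>2" 0 r a] assms
    by (simp add: circlepath_def)
  then have cauchy: "((\<lambda>t. (f (?z t))\<^sup>2 / (?z t - a) * r * \<i> * cis t)
      has_integral (2 * of_real pi * \<i> * (f a)\<^sup>2)) {0..2 * pi}"
    by (subst (asm) has_contour_integral_part_circlepath_iff) auto
  have "norm (integral {0..2 * pi} (\<lambda>t. (f (?z t))\<^sup>2 / (?z t - a) * r * \<i> * cis t))
      \<le> integral {0..2 * pi} (\<lambda>t. r / (r - norm a) * (norm (f (?z t)))\<^sup>2)"
  proof (rule integral_norm_bound_integral)
    show "(\<lambda>t. (f (?z t))\<^sup>2 / (?z t - a) * r * \<i> * cis t) integrable_on {0..2 * pi}"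
      using cauchy by blast
    show "(\<lambda>t. r / (r - norm a) * (norm (f (?z t)))\<^sup>2) integrable_on {0..2 * pi}"
      using square_mean_integrable[OF hol, of r] r assms by (intro integrable_on_mult_right) auto
  next
    fix t :: real
    have "r - norm a \<le> norm (?z t - a)"
      using norm_triangle_ineq2[of "?z t" a] r by (simp add: norm_mult)
    then have "r * (norm (f (?z t)))\<^sup>2 / norm (?z t - a) \<le> r * (norm (f (?z t)))\<^sup>2 / (r - norm a)"
      using assms r by (intro divide_left_mono) (auto intro!: mult_pos_pos)
    then show "norm ((f (?z t))\<^sup>2 / (?z t - a) * r * \<i> * cis t)
        \<le> r / (r - norm a) * (norm (f (?z t)))\<^sup>2"
      using r by (simp add: norm_mult norm_divide norm_power mult.commute)
  qed
  also have "integral {0..2 * pi} (\<lambda>t. r / (r - norm a) * (norm (f (?z t)))\<^sup>2)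
      = r / (r - norm a) * (2 * pi * square_mean f r)"
    by (simp add: square_mean_def)
  also have "integral {0..2 * pi} (\<lambda>t. (f (?z t))\<^sup>2 / (?z t - a) * r * \<i> * cis t)
      = 2 * of_real pi * \<i> * (f a)\<^sup>2"
    using cauchy by (rule integral_unique)
  finally have "2 * pi * (norm (f a))\<^sup>2 \<le> 2 * pi * (r / (r - norm a) * square_mean f r)"
    by (simp add: norm_mult norm_power mult_ac)
  then show ?thesis
    by (rule mult_left_le_imp_le) simp
qed

lemma norm_le_hardy2_norm:
  assumes "a \<in> unit_disc"
  obtains K where "\<And>f. f \<in> hardy2 \<Longrightarrow> norm (f a) \<le> K * hardy2_norm f"
proof
  \<comment> \<open>Any radius strictly between \<open>norm a\<close> and \<open>1\<close> serves.\<close>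
  define r where "r = (1 + norm a) / 2"
  have r: "norm a < r" "r < 1" "0 \<le> r"
    using assms by (auto simp: r_def)
  fix f assume f: "f \<in> hardy2"
  have "square_mean f r \<le> (SUP r\<in>{0..<1}. square_mean f r)"
    using f r by (intro cSUP_upper) (auto simp: hardy2_def)
  then have "r / (r - norm a) * square_mean f r
      \<le> r / (r - norm a) * (SUP r\<in>{0..<1}. square_mean f r)"
    using r by (intro mult_left_mono) auto
  moreover have "(norm (f a))\<^sup>2 \<le> r / (r - norm a) * square_mean f r"
    using f r by (intro norm_squared_le_square_mean) (auto simp: hardy2_def)
  ultimately have "(norm (f a))\<^sup>2 \<le> r / (r - norm a) * (SUP r\<in>{0..<1}. square_mean f r)"
    by linarith
  then have "norm (f a) \<le> sqrt (r / (r - norm a) * (SUP r\<in>{0..<1}. square_mean f r))"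
    by (rule real_le_rsqrt)
  then show "norm (f a) \<le> sqrt (r / (r - norm a)) * hardy2_norm f"
    by (simp only: hardy2_norm_def real_sqrt_mult)
qed

lemma bounded_operator_sum_of_evaluations:
  assumes "a \<in> unit_disc" "b \<in> unit_disc"
  shows "bounded_operator_hardy2 (\<lambda>f z. if z \<in> unit_disc then f a + f b else 0)"
proof -
  obtain K where K: "\<And>f. f \<in> hardy2 \<Longrightarrow> norm (f a) \<le> K * hardy2_norm f"
    using norm_le_hardy2_norm[OF assms(1)] by blast
  obtain L where L: "\<And>f. f \<in> hardy2 \<Longrightarrow> norm (f b) \<le> L * hardy2_norm f"
    using norm_le_hardy2_norm[OF assms(2)] by blast
  have "hardy2_norm (\<lambda>z. if z \<in> unit_disc then f a + f b else 0) \<le> (K + L) * hardy2_norm f"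
    if "f \<in> hardy2" for f
    using K[OF that] L[OF that] norm_triangle_ineq[of "f a" "f b"]
    unfolding hardy2_norm_constant distrib_right by linarith
  moreover have "(\<lambda>z. if z \<in> unit_disc then f a + f b else 0) \<in> hardy2" for f
    by (rule zero_extension_in_hardy2[of _ "norm (f a + f b)"]) auto
  ultimately show ?thesis
    unfolding bounded_operator_hardy2_def
    by (intro conjI ballI allI exI[of _ "K + L"]) (auto simp: fun_eq_iff algebra_simps)
qed

lemma zero_extension_power_in_hardy2:
  "(\<lambda>z. if z \<in> unit_disc then z ^ n else 0) \<in> hardy2"
  by (rule zero_extension_in_hardy2[of _ 1])
    (auto intro!: holomorphic_intros power_le_one simp: norm_power)

text \<open>
  The functions \<open>1\<close>, \<open>z\<close> and \<open>z\<^sup>2\<close> give \<open>k = 2\<close>,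
  \<open>k w = a + b\<close> and \<open>k w\<^sup>2 = a\<^sup>2 + b\<^sup>2\<close>, so the mean of the squares of
  \<open>a\<close> and \<open>b\<close> equals the square of their mean.
\<close>

lemma sum_of_evaluations_not_multiple_of_evaluation:
  assumes "a \<in> unit_disc" "b \<in> unit_disc" "w \<in> unit_disc"
    and eval: "\<And>f. f \<in> hardy2 \<Longrightarrow> f a + f b = k * f w"
  shows "a = b"
proof -
  have pow: "a ^ n + b ^ n = k * w ^ n" for n
    using eval[OF zero_extension_power_in_hardy2[of n]] assms(1-3) by simp
  have k: "k = 2"
    using pow[of 0] by simp
  have "a + b = 2 * w" "a\<^sup>2 + b\<^sup>2 = 2 * w\<^sup>2"
    using pow[of 1] pow[of 2] by (simp_all add: k)
  then have "(a - b)\<^sup>2 = 0"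
    by algebra
  then show ?thesis
    by simp
qed

theorem mainTheorem8:
  fixes \<phi> :: "complex \<Rightarrow> complex"
  assumes "bounded_analytic \<phi>"
    and "\<not> inj_on \<phi> unit_disc"
  shows "\<exists>\<psi> X. bounded_analytic \<psi> \<and>
               bounded_operator_hardy2 X \<and>
               (\<exists>f\<in>hardy2. X f \<noteq> (\<lambda>z. 0)) \<and>
               (\<forall>f\<in>hardy2. X (toeplitz \<phi> f) = toeplitz \<psi> (X f)) \<and>
               \<not> is_weighted_composition_operator X"
proof -
  obtain a b where ab: "a \<in> unit_disc" "b \<in> unit_disc" "a \<noteq> b" "\<phi> a = \<phi> b"
    using assms(2) unfolding inj_on_def by blast
  define X :: "(complex \<Rightarrow> complex) \<Rightarrow> complex \<Rightarrow> complex"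
    where "X = (\<lambda>f z. if z \<in> unit_disc then f a + f b else 0)"
  have "bounded_analytic (\<lambda>z. \<phi> a)"
    by (auto simp: bounded_analytic_def bounded_iff)
  moreover have "bounded_operator_hardy2 X"
    unfolding X_def using ab(1,2) by (rule bounded_operator_sum_of_evaluations)
  moreover have "\<exists>f\<in>hardy2. X f \<noteq> (\<lambda>z. 0)"
  proof
    show "X (\<lambda>z. if z \<in> unit_disc then z ^ 0 else 0) \<noteq> (\<lambda>z. 0)"
      using ab(1,2) by (auto simp: X_def dest!: fun_cong[of _ _ 0])
  qed (rule zero_extension_power_in_hardy2)
  moreover have "X (toeplitz \<phi> f) = toeplitz (\<lambda>z. \<phi> a) (X f)" for f
    using ab(4) by (auto simp: X_def toeplitz_def fun_eq_iff algebra_simps)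
  moreover have "\<not> is_weighted_composition_operator X"
  proof
    assume "is_weighted_composition_operator X"
    then obtain \<omega> h where \<omega>: "\<omega> ` unit_disc \<subseteq> unit_disc"
      and X: "\<And>f. f \<in> hardy2 \<Longrightarrow> X f = weighted_comp \<omega> h f"
      unfolding is_weighted_composition_operator_def by blast
    have "f a + f b = h 0 * f (\<omega> 0)" if "f \<in> hardy2" for f
      using fun_cong[OF X[OF that], of 0] by (simp add: X_def weighted_comp_def)
    moreover have "\<omega> 0 \<in> unit_disc"
      using \<omega> by force
    ultimately have "a = b"
      using sum_of_evaluations_not_multiple_of_evaluation ab(1,2) by blast
    with ab(3) show False ..
  qed
  ultimately show ?thesis
    by blast
qed

end
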